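(* Let $T_n$ be a strongly connected arc-colored tournament of order $n$ with $\Delta^{-mon}(T_n)\leq\Delta^{+mon}(T_n)$. Suppose that $$2\Delta^{-mon}(T_{n})+\Delta^{+mon}(T_{n})\leq \frac{(n-1-i(T_{n}))(n+1-i(T_{n}))}{4(n-1+i(T_{n}))}\quad\text{if } 1\leq i(T_n)<\frac{n+3}{3},$$ and $$2\Delta^{-mon}(T_{n})+\Delta^{+mon}(T_{n})\leq \frac{n-2i(T_{n})}{4}\quad\text{otherwise}.$$ Then every vertex of $T_n$ is contained in a rainbow triangle.
   Context: All digraphs are finite and simple. A tournament $T_n$ of order $n$ is a digraph on $n$ vertices in which each pair of distinct vertices is joined by precisely one arc. For a vertex $v$, $d^-(v)$ and $d^+(v)$ denote its indegree and outdegree. The irregularity is $i(T_n)=\max_{v}|d^+(v)-d^-(v)|$, the maximum being over all vertices $v$ of $T_n$. A digraph is strongly connected if for every pair of distinct vertices $u,v$ there is a directed path from $u$ to $v$. An arc-coloring is an arbitrary map from the arc set to $\mathbb{N}$, the set of natural numbers; an arc-colored tournament is a tournament equipped with an arc-coloring. $\Delta^{-mon}(T_n)$ (resp. $\Delta^{+mon}(T_n)$) is the maximum number of in-arcs (resp. out-arcs) of a same color incident to a vertex of $T_n$, the maximum being over all vertices and all colors. A triangle means a directed cycle of length $3$; it is rainbow if its three arcs have pairwise distinct colors.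
   Formalization: The order n is assumed to be at least 2; for n = 1 the statement fails, since the one-vertex tournament is strongly connected with irregularity and monochromatic degrees 0, satisfies 0 ≤ 1/4, and contains no triangle. *)

theory Defs
  imports Complex_Main "Graph_Theory.Digraph_Component"
begin

definition tournament :: "('a, 'b) pre_digraph \<Rightarrow> bool" where
  "tournament T \<longleftrightarrow> digraph T \<and>
     (\<forall>u \<in> verts T. \<forall>v \<in> verts T. u \<noteq> v \<longrightarrow>
        (\<exists>!e. e \<in> arcs T \<and> {tail T e, head T e} = {u, v}))"

definition irregularity :: "('a, 'b) pre_digraph \<Rightarrow> int" where
  "irregularity T = Max {\<bar>int (out_degree T v) - int (in_degree T v)\<bar> | v. v \<in> verts T}"

text \<open>
  An arc-coloring is a function on the arc type; its values outside \<open>arcs T\<close> are never used.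
  The sets of cardinalities below are bounded by \<open>card (arcs T)\<close> for a finite digraph, hence
  finite although the colors range over all natural numbers. They are nonempty if \<open>T\<close> has a vertex.
\<close>

definition max_mono_indegree :: "('a, 'b) pre_digraph \<Rightarrow> ('b \<Rightarrow> nat) \<Rightarrow> nat" where
  "max_mono_indegree T c = Max {card {e \<in> in_arcs T v. c e = k} | v k. v \<in> verts T}"

definition max_mono_outdegree :: "('a, 'b) pre_digraph \<Rightarrow> ('b \<Rightarrow> nat) \<Rightarrow> nat" where
  "max_mono_outdegree T c = Max {card {e \<in> out_arcs T v. c e = k} | v k. v \<in> verts T}"

definition triangle :: "('a, 'b) pre_digraph \<Rightarrow> 'b list \<Rightarrow> bool" where
  "triangle T p \<longleftrightarrow> pre_digraph.cycle T p \<and> length p = 3"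

definition rainbow :: "('b \<Rightarrow> nat) \<Rightarrow> 'b list \<Rightarrow> bool" where
  "rainbow c p \<longleftrightarrow> distinct (map c p)"

text \<open>A cycle is given by its list of arcs; its vertices are exactly the tails of these arcs.\<close>

definition in_rainbow_triangle :: "('a, 'b) pre_digraph \<Rightarrow> ('b \<Rightarrow> nat) \<Rightarrow> 'a \<Rightarrow> bool" where
  "in_rainbow_triangle T c v \<longleftrightarrow>
     (\<exists>p. triangle T p \<and> rainbow c p \<and> v \<in> tail T ` set p)"

end

theory Submission
  imports Defs
begin

text \<open>
  Fix a vertex \<open>v\<close> with out-neighbourhood \<open>O\<close> and in-neighbourhood \<open>I\<close>. The triangles through \<open>v\<close>
  are exactly the arcs from \<open>O\<close> to \<open>I\<close>, so it is enough to see that there are more such arcs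
  than arcs that spoil the rainbow property.

  \<^item> Many arcs. An arc that leaves \<open>O\<close> ends in \<open>I\<close>. Every vertex has outdegree at least
    \<open>(n - 1 - i) / 2\<close>, and only \<open>|O| (|O| - 1) / 2\<close> arcs stay inside \<open>O\<close>, which leaves at least
    \<open>|O| (n - i - |O|) / 2\<close> arcs from \<open>O\<close> to \<open>I\<close>. Reversing all arcs gives the same bound with \<open>|I|\<close>
    (\<open>cut_arcs_bounds\<close>).
  \<^item> Few bad arcs. If the triangle \<open>v \<rightarrow> x \<rightarrow> y \<rightarrow> v\<close> is not rainbow, then \<open>v \<rightarrow> x\<close> repeats its colour on
    \<open>x \<rightarrow> y\<close> or on \<open>y \<rightarrow> v\<close>, or \<open>x \<rightarrow> y\<close> has the colour of \<open>y \<rightarrow> v\<close>. Choosing first the end of the arc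
    at which the colour is prescribed bounds the number of bad arcs by
    \<open>|O| (\<Delta>\<^sup>+ + \<Delta>\<^sup>-) + |I| \<Delta>\<^sup>-\<close> (\<open>nonrainbow_bound\<close>).

  Let \<open>t\<close> be the difference of the two degrees of \<open>v\<close> in absolute value, so that \<open>0 \<le> t \<le> i\<close>, and put
  \<open>D = 2\<Delta>\<^sup>- + \<Delta>\<^sup>+\<close>. Taking the first bound for the smaller neighbourhood, what remains is
  \<open>4 (n - 1) D + 4 t \<Delta>\<^sup>+ < h t\<close> for the quadratic \<open>h t = (n - 1 - t) (n + 1 - 2 i + t)\<close>
  (\<open>arc_count_exceeds_bad_count\<close>). Here \<open>h\<close> is concave and the left side is linear in \<open>t\<close>, so only
  \<open>t = 0\<close> and \<open>t = i\<close> matter. Which endpoint is the tighter one depends on whether \<open>i < (n + 3) / 3\<close>,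
  and this is where the two hypotheses on \<open>D\<close> come from.
\<close>

section \<open>Counting arcs of a tournament relation\<close>

text \<open>
  Arcs are treated as ordered pairs here, which makes reversal of all arcs the converse relation
  and lets every statement about out-neighbours be reused for in-neighbours.
\<close>

locale tournament_relation =
  fixes V :: "'a set" and R :: "('a \<times> 'a) set"
  assumes finite_V: "finite V"
    and R_subset: "R \<subseteq> V \<times> V"
    and irreflexive: "(u, u) \<notin> R"
    and semicomplete: "u \<in> V \<Longrightarrow> w \<in> V \<Longrightarrow> u \<noteq> w \<Longrightarrow> (u, w) \<in> R \<or> (w, u) \<in> R"
    and asymmetric: "(u, w) \<in> R \<Longrightarrow> (w, u) \<notin> R"
begin

lemma converse_tournament: "tournament_relation V (R\<inverse>)"
  using finite_V R_subset irreflexive semicomplete asymmetric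
  by unfold_locales blast+

lemma finite_R: "finite R"
  using finite_V R_subset by (meson finite_SigmaI finite_subset)

lemma degree_sum:
  assumes "v \<in> V"
  shows "card (R `` {v}) + card (R\<inverse> `` {v}) + 1 = card V"
proof -
  have "V = insert v (R `` {v} \<union> R\<inverse> `` {v})"
    using assms R_subset semicomplete by blast
  moreover have "v \<notin> R `` {v} \<union> R\<inverse> `` {v}"
    using irreflexive by blast
  moreover have "R `` {v} \<inter> R\<inverse> `` {v} = {}"
    using asymmetric by blast
  moreover have "finite (R `` {v})" "finite (R\<inverse> `` {v})"
    using finite_R by (auto intro: finite_Image)
  ultimately show ?thesis
    by (metis card_Un_disjoint card_insert_disjoint finite_UnI Suc_eq_plus1)
qed

lemma card_arcs_inside:
  assumes "S \<subseteq> V"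
  shows "card S + 2 * card (R \<inter> S \<times> S) = card S * card S"
proof -
  let ?A = "R \<inter> S \<times> S"
  have fin: "finite S" "finite ?A" "finite (?A\<inverse>)"
    using assms finite_V finite_subset finite_R by auto
  have "S \<times> S = Id_on S \<union> (?A \<union> ?A\<inverse>)"
    using assms semicomplete by blast
  moreover have "Id_on S \<inter> (?A \<union> ?A\<inverse>) = {}"
    using irreflexive by auto
  moreover have "?A \<inter> ?A\<inverse> = {}"
    using asymmetric by auto
  moreover have "finite (Id_on S)"
    using fin by (simp add: Id_on_def)
  ultimately have "card (S \<times> S) = card (Id_on S) + (card ?A + card (?A\<inverse>))"
    using fin by (metis card_Un_disjoint finite_UnI)
  moreover have "card (Id_on S) = card S"
    using card_image[of "\<lambda>x. (x, x)" S] by (simp add: Id_on_def inj_on_def UNION_singleton_eq_range)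
  ultimately show ?thesis
    by (simp add: card_cartesian_product)
qed

text \<open>
  The degree sum over \<open>S\<close> counts the arcs inside \<open>S\<close> and those leaving \<open>S\<close>; the number of the
  former depends on \<open>card S\<close> only.
\<close>

lemma cut_arcs_bound:
  fixes k :: real
  assumes "S \<subseteq> V" and deg: "\<And>x. x \<in> S \<Longrightarrow> k \<le> 2 * card (R `` {x})"
  shows "card S * (k + 1 - card S) \<le> 2 * card (R \<inter> S \<times> (V - S))"
proof -
  let ?A = "R \<inter> S \<times> S" and ?B = "R \<inter> S \<times> (V - S)"
  have finS: "finite S"
    using assms(1) finite_V finite_subset by blast
  have "(\<Sum>x\<in>S. card (R `` {x})) = card (Sigma S (\<lambda>x. R `` {x}))"
    using finS finite_R by (subst card_SigmaI) auto
  also have "Sigma S (\<lambda>x. R `` {x}) = ?A \<union> ?B"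
    using R_subset by auto
  also have "card (?A \<union> ?B) = card ?A + card ?B"
    using finite_R by (intro card_Un_disjoint) auto
  finally have sum: "(\<Sum>x\<in>S. card (R `` {x})) = card ?A + card ?B" .
  have "card S * k = (\<Sum>x\<in>S. k)"
    by simp
  also have "\<dots> \<le> (\<Sum>x\<in>S. 2 * real (card (R `` {x})))"
    using deg by (intro sum_mono) simp
  also have "\<dots> = 2 * real (card ?A) + 2 * real (card ?B)"
    by (simp add: sum_distrib_left[symmetric] sum flip: of_nat_sum)
  finally have "card S * k \<le> 2 * real (card ?A) + 2 * real (card ?B)" .
  moreover have "card S + 2 * real (card ?A) = card S * real (card S)"
    using arg_cong[OF card_arcs_inside[OF assms(1)], of real] by simp
  ultimately show ?thesis
    by (simp add: algebra_simps)
qed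

lemma cut_arcs_bounds:
  fixes i :: real
  assumes "v \<in> V"
    and irr: "\<And>u. u \<in> V \<Longrightarrow> \<bar>real (card (R `` {u})) - card (R\<inverse> `` {u})\<bar> \<le> i"
  defines "p \<equiv> real (card (R `` {v}))" and "q \<equiv> real (card (R\<inverse> `` {v}))"
  shows "p * (card V - i - p) \<le> 2 * card (R \<inter> R `` {v} \<times> R\<inverse> `` {v})"
    and "q * (card V - i - q) \<le> 2 * card (R \<inter> R `` {v} \<times> R\<inverse> `` {v})"
proof -
  let ?O = "R `` {v}" and ?I = "R\<inverse> `` {v}"
  interpret conv: tournament_relation V "R\<inverse>"
    by (rule converse_tournament)
  have sub: "?O \<subseteq> V" "?I \<subseteq> V"
    using R_subset by auto
  have deg: "real (card V) - 1 - i \<le> 2 * real (card (R `` {u}))"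
    "real (card V) - 1 - i \<le> 2 * real (card (R\<inverse> `` {u}))" if "u \<in> V" for u
    using irr[OF that] arg_cong[OF degree_sum[OF that], of real] by auto
  \<comment> \<open>Besides \<open>?I\<close>, the complement of \<open>?O\<close> contains only \<open>v\<close>, which no arc from \<open>?O\<close> enters.\<close>
  have "R \<inter> ?O \<times> (V - ?O) = R \<inter> ?O \<times> ?I"
    using assms(1) R_subset semicomplete asymmetric by blast
  then show "p * (card V - i - p) \<le> 2 * card (R \<inter> ?O \<times> ?I)"
    using cut_arcs_bound[OF sub(1), of "real (card V) - 1 - i"] deg(1) sub(1) by (auto simp: p_def)
  have "R\<inverse> \<inter> ?I \<times> (V - ?I) = (R \<inter> ?O \<times> ?I)\<inverse>"
    using assms(1) R_subset semicomplete asymmetric by blast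
  then have "card (R\<inverse> \<inter> ?I \<times> (V - ?I)) = card (R \<inter> ?O \<times> ?I)"
    by (simp only: card_inverse)
  then show "q * (card V - i - q) \<le> 2 * card (R \<inter> ?O \<times> ?I)"
    using conv.cut_arcs_bound[OF sub(2), of "real (card V) - 1 - i"] deg(2) sub(2) by (auto simp: q_def)
qed

text \<open>
  Each of the three coincidences of colours prescribes, once one end of the arc from \<open>x\<close> to \<open>y\<close> is
  chosen, the colour of an arc at a known vertex: an out-arc of \<open>x\<close>, an in-arc of \<open>v\<close> and
  an in-arc of \<open>y\<close>, respectively.
\<close>

lemma nonrainbow_bound:
  fixes C :: "'a \<Rightarrow> 'a \<Rightarrow> nat"
  assumes v: "v \<in> V"
    and out: "\<And>u k. u \<in> V \<Longrightarrow> card {w. (u, w) \<in> R \<and> C u w = k} \<le> dp"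
    and inn: "\<And>u k. u \<in> V \<Longrightarrow> card {w. (w, u) \<in> R \<and> C w u = k} \<le> dm"
  shows "card {(x, y) \<in> R \<inter> R `` {v} \<times> R\<inverse> `` {v}. \<not> distinct [C v x, C x y, C y v]}
    \<le> card (R `` {v}) * (dp + dm) + card (R\<inverse> `` {v}) * dm"
proof -
  let ?O = "R `` {v}" and ?I = "R\<inverse> `` {v}"
  let ?B1 = "Sigma ?O (\<lambda>x. {y. (x, y) \<in> R \<and> C x y = C v x})"
  let ?B2 = "Sigma ?O (\<lambda>x. {y. (y, v) \<in> R \<and> C y v = C v x})"
  let ?B3 = "Sigma ?I (\<lambda>y. {x. (x, y) \<in> R \<and> C x y = C y v})"
  have fin: "finite ?O" "finite ?I" "finite (Domain R)" "finite (Range R)"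
    using finite_R by (auto intro: finite_Image finite_Domain finite_Range)
  have fin_out: "finite {w. (u, w) \<in> R \<and> P w}" and fin_in: "finite {w. (w, u) \<in> R \<and> P w}" for u P
    by (rule finite_subset[OF _ fin(4)], auto) (rule finite_subset[OF _ fin(3)], auto)
  have sub: "?O \<subseteq> V" "?I \<subseteq> V"
    using R_subset by auto
  have card_Sigma_le: "card (Sigma A F) \<le> card A * m"
    if "finite A" "\<And>x. x \<in> A \<Longrightarrow> finite (F x)" "\<And>x. x \<in> A \<Longrightarrow> card (F x) \<le> m"
    for A and F :: "'a \<Rightarrow> 'a set" and m
    using that sum_bounded_above[of A "\<lambda>x. card (F x)" m] by (simp add: card_SigmaI)
  have b1: "card ?B1 \<le> card ?O * dp"
    using fin fin_out sub out by (intro card_Sigma_le) auto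
  have b2: "card ?B2 \<le> card ?O * dm"
    using fin fin_in v inn by (intro card_Sigma_le) auto
  have b3: "card ?B3 \<le> card ?I * dm"
    using fin fin_in sub inn by (intro card_Sigma_le) auto
  have fins: "finite ?B1" "finite ?B2" "finite ?B3"
    using fin fin_out fin_in by auto
  have "{(x, y) \<in> R \<inter> ?O \<times> ?I. \<not> distinct [C v x, C x y, C y v]} \<subseteq> ?B1 \<union> ?B2 \<union> ?B3\<inverse>"
    by auto
  then have "card {(x, y) \<in> R \<inter> ?O \<times> ?I. \<not> distinct [C v x, C x y, C y v]} \<le> card (?B1 \<union> ?B2 \<union> ?B3\<inverse>)"
    using fins by (intro card_mono) auto
  also have "\<dots> \<le> card ?B1 + card ?B2 + card (?B3\<inverse>)"
    by (meson card_Un_le order_trans add_le_mono1)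
  finally show ?thesis
    using b1 b2 b3 by (simp add: algebra_simps)
qed

end

section \<open>The numerical comparison\<close>

text \<open>
  For \<open>h t = (n - 1 - t) (n + 1 - 2 i + t)\<close>, the difference between \<open>h\<close> and its chord over \<open>[0, i]\<close>
  is \<open>t (i - t)\<close>. Hence a linear function \<open>K (n - 1 + t)\<close> lies below \<open>h\<close> on the whole interval as soon
  as it does so at both ends.
\<close>

lemma linear_below_concave_quadratic:
  fixes n i t K :: real
  assumes "0 \<le> t" "t \<le> i"
    and left: "K * (n - 1) \<le> (n - 1) * (n + 1 - 2 * i)"
    and right: "K * (n - 1 + i) \<le> (n - 1 - i) * (n + 1 - i)"
  shows "K * (n - 1 + t) \<le> (n - 1 - t) * (n + 1 - 2 * i + t)"
proof (cases "t = 0")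
  case True
  then show ?thesis using left by simp
next
  case False
  then have i: "i > 0" using assms by simp
  have "i * (K * (n - 1 + t)) = (i - t) * (K * (n - 1)) + t * (K * (n - 1 + i))"
    by (simp add: algebra_simps)
  also have "\<dots> \<le> (i - t) * ((n - 1) * (n + 1 - 2 * i)) + t * ((n - 1 - i) * (n + 1 - i))"
    using assms by (intro add_mono mult_left_mono) auto
  also have "\<dots> \<le> (i - t) * ((n - 1) * (n + 1 - 2 * i)) + t * ((n - 1 - i) * (n + 1 - i))
      + i * (t * (i - t))"
    using assms i by simp
  also have "\<dots> = i * ((n - 1 - t) * (n + 1 - 2 * i + t))"
    by (simp add: algebra_simps)
  finally show ?thesis using i by simp
qed

text \<open>
  The slope \<open>K\<close> is four times the assumed bound on \<open>2 * dm + dp\<close>. In the first regime it is chosen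
  so that \<open>K (n - 1 + t)\<close> meets \<open>h\<close> at \<open>t = i\<close>, in the second so that it stays just below \<open>h\<close> at
  \<open>t = 0\<close>; in both cases the inequality at the other end follows from the sign of \<open>i (n + 3 - 3 i)\<close>.
\<close>

lemma arc_count_exceeds_bad_count:
  fixes n t dm dp :: real and i :: int
  assumes n: "n > 1" and t: "0 \<le> t" "t \<le> i" and dm: "dm > 0"
    and reg1: "1 \<le> i \<and> i < (n + 3) / 3 \<Longrightarrow>
      2 * dm + dp \<le> ((n - 1 - i) * (n + 1 - i)) / (4 * (n - 1 + i))"
    and reg2: "\<not> (1 \<le> i \<and> i < (n + 3) / 3) \<Longrightarrow> 2 * dm + dp \<le> (n - 2 * i) / 4"
  shows "4 * (n - 1) * (2 * dm + dp) + 4 * t * dp < (n - 1 - t) * (n + 1 - 2 * i + t)"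
proof -
  let ?D = "2 * dm + dp"
  have i0: "0 \<le> real_of_int i" using t by simp
  \<comment> \<open>The difference of the values of \<open>h\<close> at the two ends, after clearing denominators.\<close>
  have ends: "(n + 1 - 2 * i) * (n - 1 + i) = (n - 1 - i) * (n + 1 - i) + i * (n + 3 - 3 * i)"
    by (simp add: algebra_simps)
  have "\<exists>K. 4 * ?D \<le> K \<and> K < n + 1 - 2 * i \<and> K * (n - 1 + i) \<le> (n - 1 - i) * (n + 1 - i)"
  proof (cases "1 \<le> i \<and> i < (n + 3) / 3")
    case True
    let ?K = "((n - 1 - i) * (n + 1 - i)) / (n - 1 + i)"
    have pos: "n - 1 + i > 0" using n i0 by simp
    have "0 < i * (n + 3 - 3 * i)" using True by simp
    then have "(n - 1 - i) * (n + 1 - i) < (n + 1 - 2 * i) * (n - 1 + i)"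
      using ends by simp
    then have "?K < n + 1 - 2 * i"
      using pos by (simp add: pos_divide_less_eq)
    moreover define K where "K = ?K"
    have "(n - 1 - i) * (n + 1 - i) / (4 * (n - 1 + i)) = K / 4" by (simp add: K_def)
    then have "?D \<le> K / 4" using reg1[OF True] by (simp only:)
    then have "4 * ?D \<le> K" by simp
    moreover have "K * (n - 1 + i) = (n - 1 - i) * (n + 1 - i)" using pos by (simp add: K_def)
    ultimately show ?thesis by (intro exI[of _ K]) (simp add: K_def)
  next
    case False
    then have "i = 0 \<or> i \<ge> (n + 3) / 3" using i0 by auto
    then have "i * (n + 3 - 3 * i) \<le> 0"
      using i0 by (auto intro: mult_nonneg_nonpos)
    moreover have "(n - 2 * i) * (n - 1 + i) \<le> (n + 1 - 2 * i) * (n - 1 + i)"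
      using n i0 by (intro mult_right_mono) auto
    ultimately show ?thesis using reg2[OF False] ends by (intro exI[of _ "n - 2 * i"]) auto
  qed
  then obtain K where K: "4 * ?D \<le> K" "K < n + 1 - 2 * i"
    "K * (n - 1 + i) \<le> (n - 1 - i) * (n + 1 - i)" by blast
  have left: "K * (n - 1) < (n - 1) * (n + 1 - 2 * i)"
    using K(2) n by (simp add: mult.commute)
  have DK: "4 * ?D * (n - 1 + t) \<le> K * (n - 1 + t)"
    using K(1) n t by (intro mult_right_mono) auto
  show ?thesis
  proof (cases "t = 0")
    case True
    then show ?thesis using DK left by (simp add: algebra_simps)
  next
    case False
    \<comment> \<open>The bound on the bad arcs grows with \<open>t\<close> at rate \<open>4 dp\<close>, and \<open>dp\<close> lies strictly below \<open>2 dm + dp\<close>;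
      this gives strictness here, where \<open>K (n - 1 + t)\<close> may touch \<open>h t\<close>.\<close>
    then have "t * dm > 0" using t dm by simp
    then have "4 * (n - 1) * ?D + 4 * t * dp < 4 * ?D * (n - 1 + t)"
      by (simp add: algebra_simps)
    also note DK
    also have "K * (n - 1 + t) \<le> (n - 1 - t) * (n + 1 - 2 * i + t)"
      using linear_below_concave_quadratic[of t i K n] t left K(3) by simp
    finally show ?thesis .
  qed
qed

section \<open>Existence of a rainbow triangle\<close>

lemma (in tournament_relation) rainbow_triangle_exists:
  fixes C :: "'a \<Rightarrow> 'a \<Rightarrow> nat" and i :: int
  assumes v: "v \<in> V" and n: "card V \<ge> 2"
    and out: "\<And>u k. u \<in> V \<Longrightarrow> card {w. (u, w) \<in> R \<and> C u w = k} \<le> dp"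
    and inn: "\<And>u k. u \<in> V \<Longrightarrow> card {w. (w, u) \<in> R \<and> C w u = k} \<le> dm"
    and irr: "\<And>u. u \<in> V \<Longrightarrow> \<bar>int (card (R `` {u})) - int (card (R\<inverse> `` {u}))\<bar> \<le> i"
    and reg1: "1 \<le> i \<and> real_of_int i < (real (card V) + 3) / 3 \<Longrightarrow> 2 * real dm + real dp
      \<le> ((real (card V) - 1 - i) * (real (card V) + 1 - i)) / (4 * (real (card V) - 1 + i))"
    and reg2: "\<not> (1 \<le> i \<and> real_of_int i < (real (card V) + 3) / 3) \<Longrightarrow>
      2 * real dm + real dp \<le> (real (card V) - 2 * i) / 4"
  obtains x y where "(v, x) \<in> R" "(x, y) \<in> R" "(y, v) \<in> R" "distinct [C v x, C x y, C y v]"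
proof -
  let ?O = "R `` {v}" and ?I = "R\<inverse> `` {v}"
  let ?p = "real (card ?O)" and ?q = "real (card ?I)" and ?n = "real (card V)"
  let ?t = "\<bar>?p - ?q\<bar>"
  let ?E = "R \<inter> ?O \<times> ?I"
  let ?B = "{(x, y) \<in> ?E. \<not> distinct [C v x, C x y, C y v]}"
  have irr': "\<bar>real (card (R `` {u})) - real (card (R\<inverse> `` {u}))\<bar> \<le> i" if "u \<in> V" for u
    using irr[OF that] by linarith
  have sum: "?p + ?q = ?n - 1"
    using arg_cong[OF degree_sum[OF v], of real] by simp
  have "card ?O + card ?I \<noteq> 0"
    using degree_sum[OF v] n by linarith
  then have "R \<noteq> {}" by auto
  then obtain a b where ab: "(a, b) \<in> R" by auto
  have "finite {w. (w, b) \<in> R \<and> C w b = C a b}"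
    by (rule finite_subset[OF _ finite_Domain[OF finite_R]]) auto
  with ab have "0 < card {w. (w, b) \<in> R \<and> C w b = C a b}"
    by (auto simp: card_gt_0_iff)
  also have "\<dots> \<le> dm" using inn ab R_subset by blast
  finally have dm: "real dm > 0" by simp
  have main: "4 * (?n - 1) * (2 * real dm + dp) + 4 * ?t * dp < (?n - 1 - ?t) * (?n + 1 - 2 * i + ?t)"
    using n irr'[OF v] dm reg1 reg2 by (intro arc_count_exceeds_bad_count) auto
  \<comment> \<open>The arc bound for the smaller of the two neighbourhoods, whose size is \<open>(n - 1 - t) / 2\<close>.\<close>
  have E: "(?n - 1 - ?t) * (?n + 1 - 2 * i + ?t) \<le> 8 * real (card ?E)"
  proof (cases "?p \<le> ?q")
    case True
    then have "?n - 1 - ?t = 2 * ?p" "?n + 1 - 2 * i + ?t = 2 * (?n - i - ?p)"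
      using sum by auto
    then have "(?n - 1 - ?t) * (?n + 1 - 2 * i + ?t) = (2 * ?p) * (2 * (?n - i - ?p))"
      by (simp only:)
    also have "\<dots> \<le> 8 * real (card ?E)"
      using cut_arcs_bounds(1)[OF v irr'] by (simp add: algebra_simps)
    finally show ?thesis .
  next
    case False
    then have "?n - 1 - ?t = 2 * ?q" "?n + 1 - 2 * i + ?t = 2 * (?n - i - ?q)"
      using sum by auto
    then have "(?n - 1 - ?t) * (?n + 1 - 2 * i + ?t) = (2 * ?q) * (2 * (?n - i - ?q))"
      by (simp only:)
    also have "\<dots> \<le> 8 * real (card ?E)"
      using cut_arcs_bounds(2)[OF v irr'] by (simp add: algebra_simps)
    finally show ?thesis .
  qed
  have "real (card ?B) \<le> real (card ?O * (dp + dm) + card ?I * dm)"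
    using nonrainbow_bound[where C = C, OF v out inn] by (intro of_nat_mono) blast
  then have "8 * real (card ?B) \<le> 4 * (2 * ?p) * (dp + dm) + 4 * (2 * ?q) * dm"
    by simp
  also have "\<dots> = 4 * (?p + ?q) * (2 * real dm + dp) + 4 * (?p - ?q) * dp"
    by (simp add: algebra_simps)
  also have "\<dots> \<le> 4 * (?n - 1) * (2 * real dm + dp) + 4 * ?t * dp"
    unfolding sum by (intro add_left_mono mult_right_mono mult_left_mono) auto
  also note main
  also note E
  finally have less: "card ?B < card ?E" by simp
  have "\<not> ?E \<subseteq> ?B"
  proof
    assume "?E \<subseteq> ?B"
    then have "?B = ?E" by auto
    with less show False by simp
  qed
  then show ?thesis using that by auto
qed

section \<open>From arcs to pairs of vertices\<close>

lemma tournament_relation_arcs_ends: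
  assumes "tournament T"
  shows "tournament_relation (verts T) (arcs_ends T)"
proof -
  interpret digraph T using assms by (simp add: tournament_def)
  have uniq: "\<exists>!e. e \<in> arcs T \<and> {tail T e, head T e} = {u, w}"
    if "u \<in> verts T" "w \<in> verts T" "u \<noteq> w" for u w
    using assms that by (simp add: tournament_def)
  show ?thesis
  proof
    show "finite (verts T)" by simp
    show "arcs_ends T \<subseteq> verts T \<times> verts T" by (auto simp: arcs_ends_conv)
    show "(u, u) \<notin> arcs_ends T" for u using no_loops by (force simp: arcs_ends_conv)
  next
    fix u w assume "u \<in> verts T" "w \<in> verts T" "u \<noteq> w"
    from uniq[OF this] obtain e where e: "e \<in> arcs T" "{tail T e, head T e} = {u, w}" by blast
    then show "(u, w) \<in> arcs_ends T \<or> (w, u) \<in> arcs_ends T"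
      by (auto simp: arcs_ends_conv doubleton_eq_iff)
  next
    fix u w assume "(u, w) \<in> arcs_ends T"
    then obtain e where e: "e \<in> arcs T" "tail T e = u" "head T e = w"
      by (auto simp: arcs_ends_conv)
    show "(w, u) \<notin> arcs_ends T"
    proof
      assume "(w, u) \<in> arcs_ends T"
      then obtain e' where e': "e' \<in> arcs T" "tail T e' = w" "head T e' = u"
        by (auto simp: arcs_ends_conv)
      have "u \<noteq> w" using e no_loops by auto
      moreover have "u \<in> verts T" "w \<in> verts T" using e by auto
      moreover have "{tail T e, head T e} = {u, w}" "{tail T e', head T e'} = {u, w}"
        using e e' by auto
      ultimately have "e = e'" using uniq[of u w] e(1) e'(1) by blast
      then show False using e e' \<open>u \<noteq> w\<close> by simp
    qed
  qed
qed

lemma (in nomulti_digraph) out_degree_arcs_ends: "out_degree G u = card (arcs_ends G `` {u})"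
proof -
  have "arcs_ends G `` {u} = head G ` out_arcs G u"
    by (auto simp: arcs_ends_conv image_iff out_arcs_def)
  moreover have "inj_on (head G) (out_arcs G u)"
    using no_multi_arcs by (auto simp: inj_on_def out_arcs_def arc_to_ends_def)
  ultimately show ?thesis by (simp add: out_degree_def card_image)
qed

lemma (in nomulti_digraph) in_degree_arcs_ends: "in_degree G u = card ((arcs_ends G)\<inverse> `` {u})"
proof -
  have "(arcs_ends G)\<inverse> `` {u} = tail G ` in_arcs G u"
    by (auto simp: arcs_ends_conv image_iff in_arcs_def)
  moreover have "inj_on (tail G) (in_arcs G u)"
    using no_multi_arcs by (auto simp: inj_on_def in_arcs_def arc_to_ends_def)
  ultimately show ?thesis by (simp add: in_degree_def card_image)
qed

lemma degree_difference_le_irregularity: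
  assumes "finite (verts T)" "u \<in> verts T"
  shows "\<bar>int (out_degree T u) - int (in_degree T u)\<bar> \<le> irregularity T"
  unfolding irregularity_def using assms by (intro Max_ge) (auto simp: setcompr_eq_image)

lemma (in fin_digraph) mono_out_arcs_le:
  assumes "u \<in> verts G"
  shows "card {e \<in> out_arcs G u. c e = k} \<le> max_mono_outdegree G c"
  unfolding max_mono_outdegree_def
proof (rule Max_ge)
  show "finite {card {e \<in> out_arcs G v. c e = k} |v k. v \<in> verts G}"
    by (rule finite_subset[of _ "{..card (arcs G)}"]) (auto intro!: card_mono simp: out_arcs_def)
qed (use assms in blast)

lemma (in fin_digraph) mono_in_arcs_le:
  assumes "u \<in> verts G"
  shows "card {e \<in> in_arcs G u. c e = k} \<le> max_mono_indegree G c"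
  unfolding max_mono_indegree_def
proof (rule Max_ge)
  show "finite {card {e \<in> in_arcs G v. c e = k} |v k. v \<in> verts G}"
    by (rule finite_subset[of _ "{..card (arcs G)}"]) (auto intro!: card_mono simp: in_arcs_def)
qed (use assms in blast)

lemma (in loopfree_digraph) in_rainbow_triangleI:
  assumes "e \<in> arcs G" "f \<in> arcs G" "g \<in> arcs G"
    and "head G e = tail G f" "head G f = tail G g" "head G g = tail G e"
    and "distinct [c e, c f, c g]"
  shows "in_rainbow_triangle G c (tail G e)"
proof -
  have "tail G e \<noteq> tail G f" "tail G f \<noteq> tail G g" "tail G g \<noteq> tail G e"
    using no_loops[OF assms(1)] no_loops[OF assms(2)] no_loops[OF assms(3)] assms(4-6) by auto
  then have "cycle [e, f, g]"
    unfolding cycle_def using assms by (intro exI[of _ "tail G e"]) (auto simp: awalk_def)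
  with assms(7) show ?thesis
    unfolding in_rainbow_triangle_def triangle_def rainbow_def
    by (intro exI[of _ "[e, f, g]"]) auto
qed

theorem theorem2:
  fixes T :: "('a, 'b) pre_digraph" and c :: "'b \<Rightarrow> nat"
    and n :: nat and i :: int and dm dp :: nat
  defines "i \<equiv> irregularity T"
    and "dm \<equiv> max_mono_indegree T c"
    and "dp \<equiv> max_mono_outdegree T c"
  assumes "tournament T"
    and "card (verts T) = n"
    and "n \<ge> 2"
    and "strongly_connected T"
    and "dm \<le> dp"
    and "1 \<le> i \<and> real_of_int i < (real n + 3) / 3 \<Longrightarrow>
      2 * real dm + real dp \<le>
        ((real n - 1 - real_of_int i) * (real n + 1 - real_of_int i)) / (4 * (real n - 1 + real_of_int i))"
    and "\<not> (1 \<le> i \<and> real_of_int i < (real n + 3) / 3) \<Longrightarrow>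
      2 * real dm + real dp \<le> (real n - 2 * real_of_int i) / 4"
  shows "\<forall>v \<in> verts T. in_rainbow_triangle T c v"
proof
  fix v assume v: "v \<in> verts T"
  interpret digraph T using assms(4) by (simp add: tournament_def)
  let ?R = "arcs_ends T"
  interpret tournament_relation "verts T" ?R
    using assms(4) by (rule tournament_relation_arcs_ends)
  define C where "C u w = c (THE e. e \<in> arcs T \<and> tail T e = u \<and> head T e = w)" for u w
  have C: "C (tail T e) (head T e) = c e" if "e \<in> arcs T" for e
  proof -
    have "(THE e'. e' \<in> arcs T \<and> tail T e' = tail T e \<and> head T e' = head T e) = e"
      using that no_multi_arcs by (intro the_equality) (auto simp: arc_to_ends_def)
    then show ?thesis by (simp add: C_def)
  qed
  have out: "card {w. (u, w) \<in> ?R \<and> C u w = k} \<le> dp" if "u \<in> verts T" for u k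
  proof -
    have "{w. (u, w) \<in> ?R \<and> C u w = k} \<subseteq> head T ` {e \<in> out_arcs T u. c e = k}"
      using C by (auto simp: arcs_ends_conv out_arcs_def)
    then have "card {w. (u, w) \<in> ?R \<and> C u w = k} \<le> card {e \<in> out_arcs T u. c e = k}"
      by (rule surj_card_le[rotated]) (simp add: finite_out_arcs)
    then show ?thesis using mono_out_arcs_le[OF that] order_trans unfolding dp_def by blast
  qed
  have inn: "card {w. (w, u) \<in> ?R \<and> C w u = k} \<le> dm" if "u \<in> verts T" for u k
  proof -
    have "{w. (w, u) \<in> ?R \<and> C w u = k} \<subseteq> tail T ` {e \<in> in_arcs T u. c e = k}"
      using C by (auto simp: arcs_ends_conv in_arcs_def)
    then have "card {w. (w, u) \<in> ?R \<and> C w u = k} \<le> card {e \<in> in_arcs T u. c e = k}"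
      by (rule surj_card_le[rotated]) (simp add: finite_in_arcs)
    then show ?thesis using mono_in_arcs_le[OF that] order_trans unfolding dm_def by blast
  qed
  have irr: "\<bar>int (card (?R `` {u})) - int (card (?R\<inverse> `` {u}))\<bar> \<le> i" if "u \<in> verts T" for u
    using degree_difference_le_irregularity[OF finite_verts that]
    by (simp add: out_degree_arcs_ends in_degree_arcs_ends i_def)
  obtain x y where xy: "(v, x) \<in> ?R" "(x, y) \<in> ?R" "(y, v) \<in> ?R"
    "distinct [C v x, C x y, C y v]"
  proof (rule rainbow_triangle_exists[where C = C, OF v _ out inn irr])
    show "card (verts T) \<ge> 2" using assms(5,6) by simp
  qed (use assms(5,9,10) in auto)
  then obtain e f g where arcs: "e \<in> arcs T" "f \<in> arcs T" "g \<in> arcs T"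
    "tail T e = v" "head T e = x" "tail T f = x" "head T f = y" "tail T g = y" "head T g = v"
    by (auto simp: arcs_ends_conv)
  then have "distinct [c e, c f, c g]"
    using xy(4) C[of e] C[of f] C[of g] by simp
  then show "in_rainbow_triangle T c v"
    using in_rainbow_triangleI[of e f g c] arcs by simp
qed

end
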